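(* Let $m \geq 2$ be fixed, let $S_1, S_2$ be finite nonempty pure-strategy sets, and let $P$ be an absolutely continuous probability distribution on $\mathbb{R}$. Let $G$ be an $m$-dimensional vector-valued bimatrix game with pure-strategy sets $S_1, S_2$ in which all entries of all payoff vectors (of both players) are picked independently and identically distributed from $P$. Then $$\Pr(G_{\leq_{\text{Rlex}}} \text{ has a Nash equilibrium}) = \Pr(G_m \text{ has a pure Nash equilibrium})$$ and $$\Pr(G_{\leq_{\text{Rlex}}} \text{ has a non-pure Nash equilibrium}) = 0.$$
   Context: An $m$-dimensional vector-valued bimatrix game $G$ consists of finite nonempty pure-strategy sets $S_1, S_2$ and payoff maps $u_1, u_2: S_1 \times S_2 \to \mathbb{R}^m$, with players using mixed strategies: $\Delta_k$ is the set of probability distributions on $S_k$, and $u_k(s_1,s_2) = \sum_{\sigma_1\in S_1, \sigma_2 \in S_2} s_1(\sigma_1)s_2(\sigma_2)u_k(\sigma_1,\sigma_2)$ for $(s_1,s_2)\in\Delta_1\times\Delta_2$. Reflected lexicographic order on $\mathbb{R}^m$: $x \leq_{\text{Rlex}} y$ iff $x = y$ or there is $k$ with $x_k < y_k$ and $x_i = y_i$ for all $i > k$. A Nash equilibrium of $G_{\leq_{\text{Rlex}}}$ is $(s_1,s_2)\in\Delta_1\times\Delta_2$ with $u_1(\tilde s_1, s_2) \leq_{\text{Rlex}} u_1(s_1,s_2)$ for all $\tilde s_1\in\Delta_1$ and $u_2(s_1, \tilde s_2) \leq_{\text{Rlex}} u_2(s_1,s_2)$ for all $\tilde s_2\in\Delta_2$.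 $G_m$ is the real-valued bimatrix game (mixed extension) with the same strategies whose payoffs are the $m$-th (last) coordinates of those of $G$; its Nash equilibria are the usual ones. A strategy profile $(s_1,s_2)$ is pure if both $s_1$ and $s_2$ put probability 1 on a single pure strategy, and non-pure otherwise. *)

theory Defs
  imports "HOL-Probability.Probability"
begin

datatype player = Player1 | Player2

text \<open>A bimatrix game with payoffs in \<open>'v\<close> is given by pure-strategy sets \<open>S1\<close>, \<open>S2\<close> and a payoff map
  \<open>u :: player \<Rightarrow> 'a \<Rightarrow> 'b \<Rightarrow> 'v\<close>, whose values outside \<open>S1 \<times> S2\<close> are irrelevant.\<close>

definition mixed_strategies :: "'a set \<Rightarrow> 'a pmf set" where
  "mixed_strategies S = {s. set_pmf s \<subseteq> S}"

definition mixed_payoff ::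
  "'a set \<Rightarrow> 'b set \<Rightarrow> ('a \<Rightarrow> 'b \<Rightarrow> 'v) \<Rightarrow> 'a pmf \<Rightarrow> 'b pmf \<Rightarrow> 'v::real_vector" where
  "mixed_payoff S1 S2 v s1 s2 =
     (\<Sum>\<sigma>1\<in>S1. \<Sum>\<sigma>2\<in>S2. (pmf s1 \<sigma>1 * pmf s2 \<sigma>2) *\<^sub>R v \<sigma>1 \<sigma>2)"

text \<open>Equilibria in mixed strategies, with payoffs compared by the relation \<open>le\<close>.\<close>

definition nash_equilibria ::
  "('v \<Rightarrow> 'v \<Rightarrow> bool) \<Rightarrow> 'a set \<Rightarrow> 'b set \<Rightarrow> (player \<Rightarrow> 'a \<Rightarrow> 'b \<Rightarrow> 'v::real_vector)
     \<Rightarrow> ('a pmf \<times> 'b pmf) set" where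
  "nash_equilibria le S1 S2 u =
     {(s1, s2) \<in> mixed_strategies S1 \<times> mixed_strategies S2.
        (\<forall>t1 \<in> mixed_strategies S1.
           le (mixed_payoff S1 S2 (u Player1) t1 s2) (mixed_payoff S1 S2 (u Player1) s1 s2)) \<and>
        (\<forall>t2 \<in> mixed_strategies S2.
           le (mixed_payoff S1 S2 (u Player2) s1 t2) (mixed_payoff S1 S2 (u Player2) s1 s2))}"

definition pure_profile :: "'a pmf \<times> 'b pmf \<Rightarrow> bool" where
  "pure_profile s \<longleftrightarrow> (\<exists>\<sigma>1. pmf (fst s) \<sigma>1 = 1) \<and> (\<exists>\<sigma>2. pmf (snd s) \<sigma>2 = 1)"

definition has_nash where
  "has_nash le S1 S2 u \<longleftrightarrow> (\<exists>s. s \<in> nash_equilibria le S1 S2 u)"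

definition has_pure_nash where
  "has_pure_nash le S1 S2 u \<longleftrightarrow> (\<exists>s. s \<in> nash_equilibria le S1 S2 u \<and> pure_profile s)"

definition has_nonpure_nash where
  "has_nonpure_nash le S1 S2 u \<longleftrightarrow> (\<exists>s. s \<in> nash_equilibria le S1 S2 u \<and> \<not> pure_profile s)"

text \<open>The coordinates \<open>1, \<dots>, m\<close> are the elements of a finite linearly ordered type \<open>'m\<close>
  with \<open>CARD('m) = m\<close>; coordinate \<open>m\<close> is \<open>Max UNIV\<close>.\<close>

definition rlex_le :: "real ^ 'm::{finite,linorder} \<Rightarrow> real ^ 'm::{finite,linorder} \<Rightarrow> bool" where
  "rlex_le x y \<longleftrightarrow> x = y \<or> (\<exists>k. x $ k < y $ k \<and> (\<forall>i>k. x $ i = y $ i))"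

definition last_coordinate_game ::
  "(player \<Rightarrow> 'a \<Rightarrow> 'b \<Rightarrow> real ^ 'm::{finite,linorder}) \<Rightarrow> player \<Rightarrow> 'a \<Rightarrow> 'b \<Rightarrow> real" where
  "last_coordinate_game u = (\<lambda>p \<sigma>1 \<sigma>2. u p \<sigma>1 \<sigma>2 $ Max UNIV)"

end

theory Submission
  imports Defs
begin

text \<open>A profile is an equilibrium iff every pure strategy in a support maximises the payoff against the
  opponent. Fixing both supports decouples the condition: it constrains the second player's strategy
  only through the first player's payoffs, and conversely, by homogeneous linear equations and strict
  inequalities. Solvability of such a system is a Borel (indeed \<open>F\<^sub>\<sigma>\<close>) condition on its coefficients.

  In a non-pure equilibrium one support, say \<open>A\<close>, has at least two elements and is at least as large as
  the other support \<open>B\<close>. Indifference on \<open>A\<close> holds in all \<open>m \<ge> 2\<close> coordinates and gives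
  \<open>m (|A| - 1) \<ge> |B|\<close> homogeneous equations for the nonzero vector of probabilities on \<open>B\<close>; for
  independent atomless payoffs these almost surely have full rank. Pure equilibria are almost surely
  decided by the last coordinate, because its entries are almost surely distinct.\<close>

subsection \<open>Equilibria and best responses\<close>

definition best_response ::
  "('v \<Rightarrow> 'v \<Rightarrow> bool) \<Rightarrow> 'a set \<Rightarrow> 'b set \<Rightarrow> ('a \<Rightarrow> 'b \<Rightarrow> 'v::real_vector) \<Rightarrow> 'a pmf \<Rightarrow> 'b pmf \<Rightarrow> bool" where
  "best_response le S T v s t \<longleftrightarrow>
     (\<forall>s'\<in>mixed_strategies S. le (mixed_payoff S T v s' t) (mixed_payoff S T v s t))"

definition pure_payoff :: "'b set \<Rightarrow> ('a \<Rightarrow> 'b \<Rightarrow> 'v::real_vector) \<Rightarrow> 'b pmf \<Rightarrow> 'a \<Rightarrow> 'v" where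
  "pure_payoff T v t a = (\<Sum>b\<in>T. pmf t b *\<^sub>R v a b)"

lemma mixed_payoff_eq_sum_pure_payoff:
  "mixed_payoff S T v s t = (\<Sum>a\<in>S. pmf s a *\<^sub>R pure_payoff T v t a)"
  by (simp add: mixed_payoff_def pure_payoff_def scaleR_sum_right)

lemma mixed_payoff_flip: "mixed_payoff S T v s t = mixed_payoff T S (\<lambda>b a. v a b) t s"
  unfolding mixed_payoff_def by (subst sum.swap) (simp add: mult.commute)

lemma nash_equilibria_iff_best_response:
  "(s1, s2) \<in> nash_equilibria le S1 S2 u \<longleftrightarrow>
     s1 \<in> mixed_strategies S1 \<and> s2 \<in> mixed_strategies S2 \<and>
     best_response le S1 S2 (u Player1) s1 s2 \<and>
     best_response le S2 S1 (\<lambda>b a. u Player2 a b) s2 s1"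
  by (auto simp: nash_equilibria_def best_response_def mixed_payoff_flip[of S1 S2 "u Player2"])

text \<open>The usual order on the reals and \<open>rlex_le\<close> are both instances, so the
  description of equilibria by supports is proved once for the vector game and its last-coordinate
  game.\<close>

locale compatible_order =
  fixes le :: "'v::real_vector \<Rightarrow> 'v \<Rightarrow> bool"
  assumes refl: "le x x"
    and antisym: "le x y \<Longrightarrow> le y x \<Longrightarrow> x = y"
    and add_mono: "le x y \<Longrightarrow> le x' y' \<Longrightarrow> le (x + x') (y + y')"
    and scaleR_mono: "0 \<le> c \<Longrightarrow> le x y \<Longrightarrow> le (c *\<^sub>R x) (c *\<^sub>R y)"
begin

lemma sum_mono: "(\<And>a. a \<in> S \<Longrightarrow> le (f a) (g a)) \<Longrightarrow> le (sum f S) (sum g S)"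
  by (induction S rule: infinite_finite_induct) (auto intro: refl add_mono)

text \<open>A gap at \<open>a\<close> would have to be made up by the other summands, but these
  point the same way. Comparing the remaining sums gives the reverse inequality at
  \<open>a\<close>.\<close>

lemma sum_eq_imp_eq:
  assumes "finite S" "a \<in> S" "\<And>b. b \<in> S \<Longrightarrow> le (f b) (g b)" "sum f S = sum g S"
  shows "f a = g a"
proof -
  have "le (sum f (S - {a})) (sum g (S - {a}))"
    using assms(3) by (intro sum_mono) auto
  \<comment> \<open>The added constant turns both sides into differences from \<open>f a\<close>. As
    the totals agree, the left one equals \<open>g a - sum f (S - {a})\<close>.\<close>
  from add_mono[OF this refl[of "f a - sum f (S - {a}) - sum g (S - {a})"]]
  have "le (f a - sum g (S - {a})) (f a - sum f (S - {a}))" by (simp add: algebra_simps)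
  moreover
  have "f a + sum f (S - {a}) = g a + sum g (S - {a})"
    using assms by (simp add: sum.remove[symmetric])
  then have "f a - sum g (S - {a}) = g a - sum f (S - {a})"
    by (simp add: algebra_simps)
  ultimately have "le (g a - sum f (S - {a})) (f a - sum f (S - {a}))" by simp
  from add_mono[OF this refl[of "sum f (S - {a})"]] have "le (g a) (f a)" by simp
  with assms show ?thesis by (blast intro: antisym)
qed

text \<open>A mixed payoff is a convex combination of pure payoffs. If it bounds all of them, those
  with positive weight must equal it; conversely, supported maximisers share one value, which
  dominates every other combination.\<close>

lemma best_response_iff:
  assumes S: "finite S" and s: "s \<in> mixed_strategies S"
  shows "best_response le S T v s t \<longleftrightarrow>
    (\<forall>a\<in>set_pmf s. \<forall>a'\<in>S. le (pure_payoff T v t a') (pure_payoff T v t a))"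
    (is "_ \<longleftrightarrow> (\<forall>a\<in>_. \<forall>a'\<in>S. le (?f a') (?f a))")
proof
  have sum1: "(\<Sum>a\<in>S. pmf s' a) = 1" if "s' \<in> mixed_strategies S" for s'
    using sum_pmf_eq_1[OF S] that by (auto simp: mixed_strategies_def)
  have const: "(\<Sum>a\<in>S. pmf s' a *\<^sub>R q) = q" if "s' \<in> mixed_strategies S" for s' and q :: 'v
    using sum1[OF that] by (simp add: scaleR_sum_left[symmetric])
  {
    assume br: "best_response le S T v s t"
    define q where "q = mixed_payoff S T v s t"
    \<comment> \<open>Deviating to the point mass at \<open>a'\<close>.\<close>
    have le_q: "le (?f a') q" if "a' \<in> S" for a'
    proof -
      have "mixed_payoff S T v (return_pmf a') t = (\<Sum>a\<in>S. if a = a' then ?f a else 0)"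
        unfolding mixed_payoff_eq_sum_pure_payoff by (intro sum.cong) auto
      also have "\<dots> = ?f a'" using S that by simp
      finally show ?thesis
        using bspec[OF br[unfolded best_response_def], of "return_pmf a'"] that
        by (simp add: mixed_strategies_def q_def)
    qed
    have "?f a = q" if "a \<in> set_pmf s" for a
    proof -
      have "a \<in> S" using that s by (auto simp: mixed_strategies_def)
      moreover have "sum (\<lambda>a. pmf s a *\<^sub>R ?f a) S = sum (\<lambda>a. pmf s a *\<^sub>R q) S"
        unfolding const[OF s] by (simp add: q_def mixed_payoff_eq_sum_pure_payoff)
      ultimately have "pmf s a *\<^sub>R ?f a = pmf s a *\<^sub>R q"
        by (intro sum_eq_imp_eq[of S a "\<lambda>a. pmf s a *\<^sub>R ?f a" "\<lambda>a. pmf s a *\<^sub>R q"])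
           (auto intro: S scaleR_mono le_q)
      then show ?thesis using that by (simp add: set_pmf_iff)
    qed
    with le_q show "\<forall>a\<in>set_pmf s. \<forall>a'\<in>S. le (?f a') (?f a)" by simp
  next
    assume max: "\<forall>a\<in>set_pmf s. \<forall>a'\<in>S. le (?f a') (?f a)"
    obtain a0 where a0: "a0 \<in> set_pmf s" using set_pmf_not_empty[of s] by blast
    have eq: "?f a = ?f a0" if "a \<in> set_pmf s" for a
      using max that a0 s by (intro antisym) (auto simp: mixed_strategies_def)
    have "mixed_payoff S T v s t = (\<Sum>a\<in>S. pmf s a *\<^sub>R ?f a0)"
      unfolding mixed_payoff_eq_sum_pure_payoff
      by (intro sum.cong HOL.refl) (metis eq pmf_eq_0_set_pmf scaleR_zero_left)
    then have payoff_s: "mixed_payoff S T v s t = ?f a0" using const[OF s] by simp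
    show "best_response le S T v s t"
      unfolding best_response_def
    proof
      fix s' assume s': "s' \<in> mixed_strategies S"
      have "le (\<Sum>a\<in>S. pmf s' a *\<^sub>R ?f a) (\<Sum>a\<in>S. pmf s' a *\<^sub>R ?f a0)"
        using max a0 by (intro sum_mono scaleR_mono) auto
      then show "le (mixed_payoff S T v s' t) (mixed_payoff S T v s t)"
        unfolding const[OF s'] payoff_s unfolding mixed_payoff_eq_sum_pure_payoff .
    qed
  }
qed

end

section \<open>The two payoff orders\<close>

interpretation real_order: compatible_order "(\<le>) :: real \<Rightarrow> real \<Rightarrow> bool"
  by unfold_locales (auto intro: mult_left_mono)

interpretation rlex: compatible_order
  "rlex_le :: real ^ 'm::{finite,linorder} \<Rightarrow> _"
proof
  fix x y x' y' :: "real ^ 'm::{finite,linorder}" and c :: real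
  show "rlex_le x x" by (simp add: rlex_le_def)
  show "rlex_le x y \<Longrightarrow> rlex_le y x \<Longrightarrow> x = y"
    unfolding rlex_le_def by (metis linorder_neqE order.asym less_irrefl)
  show "rlex_le (x + x') (y + y')" if le: "rlex_le x y" "rlex_le x' y'"
  proof (cases "x = y \<or> x' = y'")
    case True
    with le show ?thesis by (auto simp: rlex_le_def)
  next
    case False
    with le obtain k k' where k: "x $ k < y $ k" "\<And>i. i > k \<Longrightarrow> x $ i = y $ i"
      and k': "x' $ k' < y' $ k'" "\<And>i. i > k' \<Longrightarrow> x' $ i = y' $ i"
      by (auto simp: rlex_le_def)
    \<comment> \<open>The higher of the two deciding coordinates decides the sum: there one pair is
      strict and the other is equal or strict too, and above it both pairs agree.\<close>
    have "(x + x') $ max k k' < (y + y') $ max k k'"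
      using k k' by (cases k k' rule: linorder_cases) (auto simp: max_def)
    moreover have "\<forall>i>max k k'. (x + x') $ i = (y + y') $ i" using k k' by simp
    ultimately show ?thesis unfolding rlex_le_def by blast
  qed
  show "rlex_le (c *\<^sub>R x) (c *\<^sub>R y)" if "0 \<le> c" "rlex_le x y"
    using that by (cases "c = 0") (auto simp: rlex_le_def)
qed

lemma rlex_le_imp_last_le:
  fixes x y :: "real ^ 'm::{finite,linorder}"
  shows "rlex_le x y \<Longrightarrow> x $ Max UNIV \<le> y $ Max UNIV"
  unfolding rlex_le_def by (metis Max_ge UNIV_I finite less_le order.refl order.strict_implies_order)

text \<open>With \<open>k = Max UNIV\<close> no coordinate lies above \<open>k\<close>, so the
  agreement condition is vacuous.\<close>

lemma last_less_imp_rlex_le: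
  fixes x y :: "real ^ 'm::{finite,linorder}"
  assumes "x $ Max UNIV < y $ Max UNIV"
  shows "rlex_le x y"
  using assms unfolding rlex_le_def by (metis Max_ge UNIV_I finite leD)

section \<open>Pure profiles\<close>

lemma set_pmf_eq_singleton_iff: "set_pmf s = {a} \<longleftrightarrow> s = return_pmf a"
  by (metis set_pmf_subset_singleton set_return_pmf subset_refl)

lemma pmf_eq_1_iff: "pmf s a = 1 \<longleftrightarrow> s = return_pmf a"
proof
  assume "pmf s a = 1"
  then have "measure_pmf.prob s {a} = 1" by (simp add: pmf.rep_eq)
  then have "AE x in measure_pmf s. x \<in> {a}" by (subst (asm) measure_pmf.prob_eq_1) auto
  then show "s = return_pmf a"
    by (auto simp: AE_measure_pmf_iff set_pmf_subset_singleton[symmetric])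
qed simp

lemma pure_profile_iff: "pure_profile (s1, s2) \<longleftrightarrow> (\<exists>a b. s1 = return_pmf a \<and> s2 = return_pmf b)"
  by (auto simp: pure_profile_def pmf_eq_1_iff)

lemma pure_payoff_return_pmf:
  assumes "finite T" "b \<in> T"
  shows "pure_payoff T v (return_pmf b) a = v a b"
proof -
  have "pure_payoff T v (return_pmf b) a = (\<Sum>b'\<in>T. if b' = b then v a b' else 0)"
    unfolding pure_payoff_def by (intro sum.cong) auto
  then show ?thesis using assms by simp
qed

text \<open>Against a point mass the pure payoffs are matrix entries, so mixed deviations reduce to
  finitely many comparisons of entries. This gives both measurability of the pure event and the
  comparison of the two orders.\<close>

lemma (in compatible_order) has_pure_nash_iff:
  assumes "finite S1" "finite S2"
  shows "has_pure_nash le S1 S2 u \<longleftrightarrow>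
    (\<exists>a\<in>S1. \<exists>b\<in>S2. (\<forall>a'\<in>S1. le (u Player1 a' b) (u Player1 a b)) \<and>
                    (\<forall>b'\<in>S2. le (u Player2 a b') (u Player2 a b)))"
proof -
  have "has_pure_nash le S1 S2 u \<longleftrightarrow>
    (\<exists>a b. (return_pmf a, return_pmf b) \<in> nash_equilibria le S1 S2 u)"
    unfolding has_pure_nash_def by (force simp: pure_profile_iff)
  also have "\<dots> \<longleftrightarrow> (\<exists>a\<in>S1. \<exists>b\<in>S2. (\<forall>a'\<in>S1. le (u Player1 a' b) (u Player1 a b)) \<and>
                    (\<forall>b'\<in>S2. le (u Player2 a b') (u Player2 a b)))"
  proof -
    have "(return_pmf a, return_pmf b) \<in> nash_equilibria le S1 S2 u \<longleftrightarrow>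
        a \<in> S1 \<and> b \<in> S2 \<and> (\<forall>a'\<in>S1. le (u Player1 a' b) (u Player1 a b)) \<and>
                    (\<forall>b'\<in>S2. le (u Player2 a b') (u Player2 a b))" for a b
    proof (cases "a \<in> S1 \<and> b \<in> S2")
      case True
      then have "return_pmf a \<in> mixed_strategies S1" "return_pmf b \<in> mixed_strategies S2"
        by (auto simp: mixed_strategies_def)
      with True assms show ?thesis
        by (simp add: nash_equilibria_iff_best_response best_response_iff pure_payoff_return_pmf)
    qed (auto simp: nash_equilibria_iff_best_response mixed_strategies_def)
    then show ?thesis by blast
  qed
  finally show ?thesis .
qed

subsection \<open>Measurability of linear feasibility\<close>

text \<open>Outside \<open>B\<close> the functions are pinned to \<open>undefined\<close>; a
  singleton factor is compact, so Tychonoff applies to the product over all indices.\<close>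

lemma compact_PiE_euclidean:
  fixes K :: "'b \<Rightarrow> real set"
  assumes "\<And>b. b \<in> B \<Longrightarrow> compact (K b)"
  shows "compact (PiE B K)"
proof -
  have "PiE B K = PiE UNIV (\<lambda>b. if b \<in> B then K b else {undefined})"
    by (auto simp: PiE_def Pi_def extensional_def)
  moreover have "compactin (product_topology (\<lambda>_. euclidean) UNIV)
      (PiE UNIV (\<lambda>b. if b \<in> B then K b else {undefined}))"
    using assms by (subst compactin_PiE) (auto simp: compactin_euclidean_iff)
  ultimately show ?thesis
    by (simp add: euclidean_product_topology)
qed

text \<open>The approximants must not leave the interval. An interior point can be approached from
  above; the endpoints are rational and approximate themselves.\<close>

lemma rational_sequence_tendsto:
  fixes x :: real and n :: nat
  assumes "\<bar>x\<bar> \<le> real n"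
  obtains q where "\<And>j::nat. q j \<in> \<rat>" "\<And>j. \<bar>q j\<bar> \<le> real n" "q \<longlonglongrightarrow> x"
proof -
  consider "x \<in> \<rat>" | "- real n < x" "x < real n"
  proof -
    have "x = real n \<or> x = - real n \<or> (- real n < x \<and> x < real n)" using assms by linarith
    then show thesis using that by auto
  qed
  then show thesis
  proof cases
    case 1
    with assms show ?thesis by (intro that[of "\<lambda>_. x"]) auto
  next
    case 2
    have "\<exists>r. r \<in> \<rat> \<and> x < r \<and> r < min (real n) (x + 1 / Suc j)" for j
      using Rats_dense_in_real[of x "min (real n) (x + 1 / Suc j)"] 2 by auto
    then obtain q where q: "\<And>j. q j \<in> \<rat>" "\<And>j. x < q j" "\<And>j. q j < min (real n) (x + 1 / Suc j)"
      by metis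
    have "(\<lambda>j. x + 1 / Suc j) \<longlonglongrightarrow> x + 0"
      by (intro tendsto_add tendsto_const LIMSEQ_inverse_real_of_nat[unfolded inverse_eq_divide])
    then have "(\<lambda>j. x + 1 / Suc j) \<longlonglongrightarrow> x" by simp
    moreover have "x \<le> q j" "q j \<le> x + 1 / Suc j" for j
      using q(2)[of j] q(3)[of j] by auto
    ultimately have "q \<longlonglongrightarrow> x"
      by (intro tendsto_sandwich[of "\<lambda>_. x" q sequentially "\<lambda>j. x + 1 / Suc j"] tendsto_const always_eventually) auto
    moreover have "\<bar>q j\<bar> \<le> real n" for j using q(2)[of j] q(3)[of j] 2 by auto
    ultimately show ?thesis using q(1) that by blast
  qed
qed

text \<open>By homogeneity the strict inequalities may be replaced by \<open>\<ge> 1\<close>, after which solvability in a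
  bounded box is, by compactness, approximate solvability by rational points.\<close>

lemma sets_linear_feasibility:
  fixes c :: "'j \<Rightarrow> 'b \<Rightarrow> 'w \<Rightarrow> real"
  assumes B: "finite B" and E: "finite E" and F: "finite F"
    and c [measurable]: "\<And>j b. j \<in> E \<union> F \<Longrightarrow> b \<in> B \<Longrightarrow> c j b \<in> borel_measurable M"
  shows "{w \<in> space M. \<exists>x. (\<forall>j\<in>E. (\<Sum>b\<in>B. c j b w * x b) = 0) \<and>
                            (\<forall>j\<in>F. (\<Sum>b\<in>B. c j b w * x b) > 0)} \<in> sets M"
proof -
  \<comment> \<open>A continuous penalty that vanishes exactly when all equations hold and all
    inequalities hold with margin 1.\<close>
  define f where "f w x = (\<Sum>j\<in>E. \<bar>\<Sum>b\<in>B. c j b w * x b\<bar>) +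
      (\<Sum>j\<in>F. max 0 (1 - (\<Sum>b\<in>B. c j b w * x b)))" for w and x :: "'b \<Rightarrow> real"
  define box where "box n = PiE B (\<lambda>_. {- real n .. real n})" for n :: nat
  define Q where "Q n = PiE B (\<lambda>_. {- real n .. real n} \<inter> \<rat>)" for n :: nat
  have Q_countable: "countable (Q n)" for n
    unfolding Q_def using B countable_rat by (intro countable_PiE) auto
  have Q_box: "Q n \<subseteq> box n" for n by (auto simp: Q_def box_def)
  have f_nonneg: "f w x \<ge> 0" for w x
    unfolding f_def by (intro add_nonneg_nonneg sum_nonneg) auto
  have f_0: "f w x = 0 \<longleftrightarrow> (\<forall>j\<in>E. (\<Sum>b\<in>B. c j b w * x b) = 0) \<and>
      (\<forall>j\<in>F. (\<Sum>b\<in>B. c j b w * x b) \<ge> 1)" for w x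
    unfolding f_def
    by (subst add_nonneg_eq_0_iff)
       (auto simp: sum_nonneg_eq_0_iff E F max_def intro!: sum_nonneg split: if_splits)
  \<comment> \<open>Left to right uses density of \<open>Q n\<close> in the box and continuity;
    right to left uses that the penalty attains its minimum on the compact box.\<close>
  have approx: "(\<exists>x\<in>box n. f w x = 0) \<longleftrightarrow> (\<forall>k::nat. \<exists>x\<in>Q n. f w x < 1 / Suc k)" for n w
  proof
    assume "\<exists>x\<in>box n. f w x = 0"
    then obtain x where x: "x \<in> box n" "f w x = 0" by blast
    have "\<exists>q. (\<forall>j::nat. q j \<in> \<rat> \<and> \<bar>q j\<bar> \<le> real n) \<and> q \<longlonglongrightarrow> x b" if "b \<in> B" for b
    proof -
      have "\<bar>x b\<bar> \<le> real n" using x(1) that by (fastforce simp: box_def PiE_def Pi_def)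
      from rational_sequence_tendsto[OF this] show ?thesis by metis
    qed
    then obtain q where q: "\<And>b j. b \<in> B \<Longrightarrow> q b j \<in> \<rat> \<and> \<bar>q b j\<bar> \<le> real n"
        "\<And>b. b \<in> B \<Longrightarrow> q b \<longlonglongrightarrow> x b"
      by metis
    define y where "y j = (\<lambda>b\<in>B. q b j)" for j
    have "q b j \<in> {- real n..real n} \<inter> \<rat>" if "b \<in> B" for b j
      using q(1)[OF that, of j] by (simp add: abs_le_iff minus_le_iff)
    then have y: "y j \<in> Q n" for j by (simp add: y_def Q_def)
    have "(\<lambda>j. y j b) \<longlonglongrightarrow> x b" if "b \<in> B" for b using q(2)[OF that] that by (simp add: y_def)
    then have "(\<lambda>j. f w (y j)) \<longlonglongrightarrow> f w x"
      unfolding f_def by (intro tendsto_intros) auto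
    then have lim: "(\<lambda>j. f w (y j)) \<longlonglongrightarrow> 0" using x by simp
    show "\<forall>k. \<exists>x\<in>Q n. f w x < 1 / Suc k"
    proof
      fix k :: nat
      have "eventually (\<lambda>j. f w (y j) < 1 / Suc k) sequentially"
        using lim by (rule order_tendstoD) simp
      then obtain j where "f w (y j) < 1 / Suc k" by (auto simp: eventually_sequentially)
      with y show "\<exists>x\<in>Q n. f w x < 1 / Suc k" by blast
    qed
  next
    assume *: "\<forall>k::nat. \<exists>x\<in>Q n. f w x < 1 / Suc k"
    have "compact (box n)" unfolding box_def by (intro compact_PiE_euclidean) simp
    moreover have "box n \<noteq> {}" using * Q_box by blast
    moreover have "continuous_on (box n) (f w)"
      unfolding f_def
      by (intro continuous_intros continuous_on_product_coordinates[THEN continuous_on_subset]) auto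
    ultimately obtain x where x: "x \<in> box n" "\<And>y. y \<in> box n \<Longrightarrow> f w x \<le> f w y"
      using continuous_attains_inf by metis
    have "f w x \<le> 0"
    proof (rule ccontr)
      assume "\<not> f w x \<le> 0"
      then obtain k where "inverse (real (Suc k)) < f w x"
        using reals_Archimedean by (metis not_le)
      moreover obtain y where "y \<in> Q n" "f w y < 1 / Suc k" using * by blast
      ultimately show False using x(2)[of y] Q_box by (auto simp: inverse_eq_divide)
    qed
    with f_nonneg[of w x] x show "\<exists>x\<in>box n. f w x = 0" by (intro bexI[of _ x]) auto
  qed
  have homogeneous: "(\<exists>x. (\<forall>j\<in>E. (\<Sum>b\<in>B. c j b w * x b) = 0) \<and>
      (\<forall>j\<in>F. (\<Sum>b\<in>B. c j b w * x b) > 0)) \<longleftrightarrow> (\<exists>n. \<exists>x\<in>box n. f w x = 0)" for w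
  proof
    assume "\<exists>x. (\<forall>j\<in>E. (\<Sum>b\<in>B. c j b w * x b) = 0) \<and> (\<forall>j\<in>F. (\<Sum>b\<in>B. c j b w * x b) > 0)"
    then obtain x where x: "\<And>j. j \<in> E \<Longrightarrow> (\<Sum>b\<in>B. c j b w * x b) = 0"
      "\<And>j. j \<in> F \<Longrightarrow> (\<Sum>b\<in>B. c j b w * x b) > 0" by blast
    define L where "L j = (\<Sum>b\<in>B. c j b w * x b)" for j
    \<comment> \<open>All summands are positive, so \<open>d\<close> is at least each
      \<open>1 / L j\<close> and scaling by \<open>d\<close> gives margin 1. If \<open>F\<close> is
      empty then \<open>d = 0\<close>, and the zero vector solves the equations.\<close>
    define d where "d = (\<Sum>j\<in>F. 1 / L j)"
    define y where "y = (\<lambda>b\<in>B. d * x b)"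
    have Ly: "(\<Sum>b\<in>B. c j b w * y b) = d * L j" for j
      unfolding L_def y_def sum_distrib_left by (intro sum.cong) auto
    have "d * L j \<ge> 1" if "j \<in> F" for j
    proof -
      have "1 / L j \<le> d"
        unfolding d_def using x(2) F that by (intro member_le_sum) (auto simp: L_def less_imp_le)
      then show ?thesis using x(2)[OF that] by (simp add: L_def field_simps)
    qed
    then have "f w y = 0" using x(1) by (simp add: f_0 Ly) (simp add: L_def)
    moreover obtain n :: nat where "(\<Sum>b\<in>B. \<bar>y b\<bar>) \<le> real n" using real_arch_simple by blast
    then have "\<bar>y b\<bar> \<le> real n" if "b \<in> B" for b
      using member_le_sum[of b B "\<lambda>b. \<bar>y b\<bar>"] B that by auto
    then have "y \<in> box n" by (force simp: box_def y_def abs_le_iff)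
    ultimately show "\<exists>n. \<exists>x\<in>box n. f w x = 0" by blast
  next
    assume "\<exists>n. \<exists>x\<in>box n. f w x = 0"
    then show "\<exists>x. (\<forall>j\<in>E. (\<Sum>b\<in>B. c j b w * x b) = 0) \<and> (\<forall>j\<in>F. (\<Sum>b\<in>B. c j b w * x b) > 0)"
      by (force simp: f_0)
  qed
  have [measurable]: "(\<lambda>w. f w x) \<in> borel_measurable M" for x
    unfolding f_def using c by (intro borel_measurable_add borel_measurable_sum borel_measurable_abs
        borel_measurable_max borel_measurable_diff borel_measurable_times borel_measurable_const) auto
  have "{w \<in> space M. \<exists>n. \<forall>k::nat. \<exists>x\<in>Q n. f w x < 1 / Suc k} \<in> sets M"
    using Q_countable by (intro sets.sets_Collect_countable_Ex sets.sets_Collect_countable_All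
        sets.sets_Collect_countable_Ex') measurable
  then show ?thesis by (simp only: homogeneous approx)
qed

subsection \<open>Generic regularity of random matrices\<close>

text \<open>Fubini with coordinate \<open>i\<close> integrated first: with the other coordinates
  fixed, the exceptional values form a countable set, which is null because \<open>P\<close> has no
  atoms.\<close>

lemma AE_PiM_countable_slices:
  assumes I: "finite I" "i \<in> I" and P: "prob_space P" "sets P = sets borel"
    and atomless: "\<And>x. emeasure P {x} = 0"
    and meas: "{w \<in> space (PiM I (\<lambda>_. P)). Q w} \<in> sets (PiM I (\<lambda>_. P))"
    and slices: "\<And>w. countable {x :: real. Q (w(i := x))}"
  shows "AE w in PiM I (\<lambda>_. P). \<not> Q w"
proof -
  interpret P: prob_space P by fact
  interpret product_sigma_finite "\<lambda>_. P" by unfold_locales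
  define J where "J = I - {i}"
  have J: "finite J" "i \<notin> J" "I = insert i J" using I by (auto simp: J_def)
  let ?A = "{w \<in> space (PiM I (\<lambda>_. P)). Q w}"
  have "emeasure (PiM I (\<lambda>_. P)) ?A = (\<integral>\<^sup>+ w. indicator ?A w \<partial>PiM (insert i J) (\<lambda>_. P))"
    using meas J by simp
  also have "\<dots> = (\<integral>\<^sup>+ w. (\<integral>\<^sup>+ x. indicator ?A (w(i := x)) \<partial>P) \<partial>PiM J (\<lambda>_. P))"
    using meas J by (intro product_nn_integral_insert) auto
  also have "\<dots> = (\<integral>\<^sup>+ w. 0 \<partial>PiM J (\<lambda>_. P))"
  proof (intro nn_integral_cong)
    fix w
    have "{x. Q (w(i := x))} \<in> null_sets P"
    proof -
      have "(\<Union>x\<in>{x. Q (w(i := x))}. {x}) \<in> null_sets P"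
        using slices[of w] P(2) by (intro null_sets_UN') (auto simp: null_sets_def atomless)
      then show ?thesis by simp
    qed
    then have "AE x in P. indicator ?A (w(i := x)) = (0 :: ennreal)"
      by (rule AE_I') (auto simp: indicator_def)
    then show "(\<integral>\<^sup>+ x. indicator ?A (w(i := x)) \<partial>P) = 0"
      by (simp cong: nn_integral_cong_AE)
  qed
  finally have "?A \<in> null_sets (PiM I (\<lambda>_. P))" using meas by (simp add: null_sets_def)
  then show ?thesis by (rule AE_I') auto
qed

text \<open>A nontrivial kernel, rather than a vanishing determinant, is what indifference of a
  player produces, and it is a linear system of the kind shown measurable above. Over the empty
  index set nothing is singular.\<close>

definition singular :: "'b set \<Rightarrow> ('b \<Rightarrow> 'b \<Rightarrow> real) \<Rightarrow> bool" where
  "singular B A \<longleftrightarrow> (\<exists>y. (\<exists>c\<in>B. y c \<noteq> 0) \<and> (\<forall>b\<in>B. (\<Sum>c\<in>B. A b c * y c) = 0))"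

lemma singular_cong:
  "(\<And>b c. b \<in> B \<Longrightarrow> c \<in> B \<Longrightarrow> A b c = A' b c) \<Longrightarrow> singular B A = singular B A'"
  unfolding singular_def by (intro ex_cong1 conj_cong ball_cong refl) (simp cong: sum.cong)

text \<open>The determinant is affine in the entry at \<open>(b, b)\<close>, with the determinant of
  the block on \<open>B\<close> as slope, so it has at most one root when that block is regular. The
  proof argues with kernel vectors \<open>y\<close> of \<open>A\<close> and \<open>z\<close> of
  \<open>A'\<close> instead.\<close>

lemma singular_insert_entry_unique:
  assumes B: "finite B" "b \<notin> B" and ns: "\<not> singular B A"
    and sing: "singular (insert b B) A" "singular (insert b B) A'"
    and eq: "\<And>r c. r \<in> insert b B \<Longrightarrow> c \<in> insert b B \<Longrightarrow> (r, c) \<noteq> (b, b) \<Longrightarrow> A' r c = A r c"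
  shows "A' b b = A b b"
proof -
  \<comment> \<open>A kernel vector vanishing at \<open>b\<close> would restrict to a kernel vector
    of the regular block.\<close>
  have nz: "y b \<noteq> 0"
    if "\<exists>c\<in>insert b B. y c \<noteq> 0" "\<forall>r\<in>insert b B. (\<Sum>c\<in>insert b B. A r c * y c) = 0"
      "\<not> singular B A" for y A
    using that B unfolding singular_def by auto
  from sing(1) obtain y where y: "\<exists>c\<in>insert b B. y c \<noteq> 0"
    "\<forall>r\<in>insert b B. (\<Sum>c\<in>insert b B. A r c * y c) = 0" unfolding singular_def by blast
  from sing(2) obtain z where z: "\<exists>c\<in>insert b B. z c \<noteq> 0"
    "\<forall>r\<in>insert b B. (\<Sum>c\<in>insert b B. A' r c * z c) = 0" unfolding singular_def by blast
  have "\<not> singular B A'" using ns eq B by (subst singular_cong[of B A' A]) auto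
  then have "y b \<noteq> 0" "z b \<noteq> 0" using nz[OF y ns] nz[OF z] by auto
  have y': "A r b * y b + (\<Sum>c\<in>B. A r c * y c) = 0" if "r \<in> insert b B" for r
    using bspec[OF y(2) that] B by simp
  have z': "A' r b * z b + (\<Sum>c\<in>B. A r c * z c) = 0" if "r \<in> insert b B" for r
  proof -
    have "(\<Sum>c\<in>B. A r c * z c) = (\<Sum>c\<in>B. A' r c * z c)"
    proof (intro sum.cong refl)
      fix c assume "c \<in> B"
      then have "A' r c = A r c" using B that by (intro eq) auto
      then show "A r c * z c = A' r c * z c" by simp
    qed
    then show ?thesis using bspec[OF z(2) that] B by simp
  qed
  \<comment> \<open>This combination cancels the component at \<open>b\<close>. Rows in
    \<open>B\<close> annihilate it, so it vanishes on \<open>B\<close> by regularity; row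
    \<open>b\<close> then isolates the difference of the two corner entries.\<close>
  define d where "d c = z b * y c - y b * z c" for c
  have d: "(\<Sum>c\<in>B. A r c * d c) = y b * z b * (A' r b - A r b)" if "r \<in> insert b B" for r
  proof -
    have "(\<Sum>c\<in>B. A r c * d c) = z b * (\<Sum>c\<in>B. A r c * y c) - y b * (\<Sum>c\<in>B. A r c * z c)"
      by (simp add: d_def sum_distrib_left sum_subtractf[symmetric] algebra_simps)
    also have "(\<Sum>c\<in>B. A r c * y c) = - (A r b * y b)" using y'[OF that] by simp
    also have "(\<Sum>c\<in>B. A r c * z c) = - (A' r b * z b)" using z'[OF that] by simp
    finally show ?thesis by (simp add: algebra_simps)
  qed
  have "\<forall>r\<in>B. (\<Sum>c\<in>B. A r c * d c) = 0" using d eq B by auto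
  then have "\<forall>c\<in>B. d c = 0" using ns unfolding singular_def by blast
  then have "y b * z b * (A' b b - A b b) = 0" using d[of b] by simp
  with \<open>y b \<noteq> 0\<close> \<open>z b \<noteq> 0\<close> show ?thesis by simp
qed

text \<open>After a change of sign, some coordinate \<open>c0\<close> of a kernel vector is
  positive. So singularity is a finite union, over \<open>c0\<close>, of systems of linear equations
  with one strict inequality.\<close>

lemma sets_singular:
  fixes A :: "'w \<Rightarrow> 'b \<Rightarrow> 'b \<Rightarrow> real"
  assumes B: "finite B"
    and A: "\<And>b c. b \<in> B \<Longrightarrow> c \<in> B \<Longrightarrow> (\<lambda>w. A w b c) \<in> borel_measurable M"
  shows "{w \<in> space M. singular B (A w)} \<in> sets M"
proof -
  \<comment> \<open>\<open>Some r\<close> encodes the equation of row \<open>r\<close>, and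
    \<open>None\<close> the inequality for the coordinate \<open>c0\<close>.\<close>
  define c :: "'b option \<Rightarrow> 'b \<Rightarrow> 'b \<Rightarrow> 'w \<Rightarrow> real" where
    "c j c0 b w = (case j of Some r \<Rightarrow> A w r b | None \<Rightarrow> of_bool (b = c0))" for j c0 b w
  have None: "(\<Sum>b\<in>B. c None c0 b w * x b) = x c0" if "c0 \<in> B" for c0 w x
    using B that by (simp add: c_def of_bool_def if_distrib[of "\<lambda>a. a * _"] cong: if_cong)
  have Some: "(\<Sum>b\<in>B. c (Some r) c0 b w * x b) = (\<Sum>b\<in>B. A w r b * x b)" for r c0 w x
    by (simp add: c_def)
  have iff: "singular B (A w) \<longleftrightarrow> (\<exists>c0\<in>B. \<exists>x. (\<forall>j\<in>Some ` B. (\<Sum>b\<in>B. c j c0 b w * x b) = 0) \<and>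
                            (\<forall>j\<in>{None}. (\<Sum>b\<in>B. c j c0 b w * x b) > 0))" (is "_ \<longleftrightarrow> ?rhs") for w
  proof
    assume "singular B (A w)"
    then obtain y c0 where y: "c0 \<in> B" "y c0 \<noteq> 0" "\<forall>b\<in>B. (\<Sum>c\<in>B. A w b c * y c) = 0"
      unfolding singular_def by blast
    have "\<forall>b\<in>B. (\<Sum>c\<in>B. A w b c * (sgn (y c0) * y c)) = 0"
      using y(3) by (simp add: mult.left_commute[of _ "sgn (y c0)"] sum_distrib_left[symmetric])
    moreover have "sgn (y c0) * y c0 > 0" using y(2) by (simp add: sgn_if)
    ultimately show ?rhs
      using y(1) by (intro bexI[of _ c0] exI[of _ "\<lambda>c. sgn (y c0) * y c"]) (simp add: None Some)
  next
    assume ?rhs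
    then obtain c0 x where x: "c0 \<in> B" "\<forall>b\<in>B. (\<Sum>c\<in>B. A w b c * x c) = 0" "x c0 > 0"
      by (auto simp: None Some)
    then show "singular B (A w)"
      unfolding singular_def by (intro exI[of _ x] conjI bexI[of _ c0]) auto
  qed
  have *: "{w \<in> space M. singular B (A w)} = (\<Union>c0\<in>B. {w \<in> space M. \<exists>x.
        (\<forall>j\<in>Some ` B. (\<Sum>b\<in>B. c j c0 b w * x b) = 0) \<and>
        (\<forall>j\<in>{None}. (\<Sum>b\<in>B. c j c0 b w * x b) > 0)})"
    unfolding iff by blast
  show ?thesis unfolding *
    using B by (intro sets.finite_UN sets_linear_feasibility)
      (auto simp: c_def intro: A)
qed

text \<open>Adding a row and column keeps the matrix regular unless the new diagonal entry, which is
  independent of the other entries, takes one exceptional value.\<close>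

lemma AE_not_singular:
  fixes A :: "('i \<Rightarrow> real) \<Rightarrow> 'b \<Rightarrow> 'b \<Rightarrow> real"
  assumes I: "finite I" and P: "prob_space P" "sets P = sets borel"
    and atomless: "\<And>x. emeasure P {x} = 0"
    and B: "finite B"
    and A: "\<And>b c. b \<in> B \<Longrightarrow> c \<in> B \<Longrightarrow> (\<lambda>w. A w b c) \<in> borel_measurable (PiM I (\<lambda>_. P))"
    and d: "\<And>b. b \<in> B \<Longrightarrow> d b \<in> I"
    and diag: "\<And>w b x x'. b \<in> B \<Longrightarrow> A (w(d b := x)) b b = A (w(d b := x')) b b \<Longrightarrow> x = x'"
    and off_diag: "\<And>w b r c x. b \<in> B \<Longrightarrow> r \<in> B \<Longrightarrow> c \<in> B \<Longrightarrow> (r, c) \<noteq> (b, b) \<Longrightarrow>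
                     A (w(d b := x)) r c = A w r c"
  shows "AE w in PiM I (\<lambda>_. P). \<not> singular B (A w)"
  using B A d diag off_diag
proof (induction B rule: finite_induct)
  case empty
  then show ?case by (simp add: singular_def)
next
  case (insert b B)
  have IH: "AE w in PiM I (\<lambda>_. P). \<not> singular B (A w)"
  proof (rule insert.IH)
    fix w b x x' assume "b \<in> B" "A (w(d b := x)) b b = A (w(d b := x')) b b"
    then show "x = x'" using insert.prems(3)[of b w x x'] by blast
  next
    fix w b' r c x assume "b' \<in> B" "r \<in> B" "c \<in> B" "(r, c) \<noteq> (b', b')"
    then show "A (w(d b' := x)) r c = A w r c" using insert.prems(4)[of b' r c w x] by blast
  qed (use insert.prems(1,2) in auto)
  \<comment> \<open>Regularity of the smaller block is built into the exceptional event, so that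
    each slice along \<open>d b\<close> has at most one point.\<close>
  let ?Q = "\<lambda>w. singular (insert b B) (A w) \<and> \<not> singular B (A w)"
  have "AE w in PiM I (\<lambda>_. P). \<not> ?Q w"
  proof (rule AE_PiM_countable_slices[OF I _ P atomless])
    show "d b \<in> I" using insert.prems(2) by simp
    have "{w \<in> space (PiM I (\<lambda>_. P)). ?Q w} =
        {w \<in> space (PiM I (\<lambda>_. P)). singular (insert b B) (A w)} -
        {w \<in> space (PiM I (\<lambda>_. P)). singular B (A w)}" by blast
    also have "\<dots> \<in> sets (PiM I (\<lambda>_. P))"
      using insert.hyps insert.prems(1) by (intro sets.Diff sets_singular) auto
    finally show "{w \<in> space (PiM I (\<lambda>_. P)). ?Q w} \<in> sets (PiM I (\<lambda>_. P))" .
  next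
    fix w
    define Z where "Z = {x. ?Q (w(d b := x))}"
    have "x = x'" if "x \<in> Z" "x' \<in> Z" for x x'
    proof -
      have "(A (w(d b := x'))) b b = (A (w(d b := x))) b b"
      proof (rule singular_insert_entry_unique[of B b "A (w(d b := x))" "A (w(d b := x'))"])
        show "A (w(d b := x')) r c = A (w(d b := x)) r c"
          if "r \<in> insert b B" "c \<in> insert b B" "(r, c) \<noteq> (b, b)" for r c
          by (simp only: insert.prems(4)[OF insertI1 that])
      qed (use that insert.hyps in \<open>auto simp: Z_def\<close>)
      then show ?thesis by (rule insert.prems(3)[OF insertI1, OF sym])
    qed
    then have "Z = {} \<or> (\<exists>x0. Z \<subseteq> {x0})" by blast
    then have "countable Z" by (metis countable_empty countable_insert countable_subset)
    then show "countable {x. ?Q (w(d b := x))}" by (simp only: Z_def)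
  qed
  with IH show ?case by eventually_elim blast
qed

subsection \<open>Equilibria with prescribed supports\<close>

text \<open>Turns a positive solution of a homogeneous system into a mixed strategy with prescribed
  support.\<close>

lemma ex_pmf_proportional:
  fixes x :: "'b \<Rightarrow> real"
  assumes B: "finite B" "B \<noteq> {}" and x: "\<And>b. b \<in> B \<Longrightarrow> x b > 0"
  obtains t where "set_pmf t = B" "\<And>b. b \<in> B \<Longrightarrow> pmf t b = x b / sum x B"
proof -
  define f where "f b = (if b \<in> B then x b / sum x B else 0)" for b
  have pos: "sum x B > 0" using B x by (intro sum_pos) auto
  have nonneg: "f b \<ge> 0" for b using x pos by (auto simp: f_def less_imp_le)
  have "(\<integral>\<^sup>+ b. ennreal (f b) \<partial>count_space UNIV) = (\<integral>\<^sup>+ b. ennreal (f b) \<partial>count_space B)"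
    by (intro nn_integral_count_space_eq) (auto simp: f_def)
  also have "\<dots> = ennreal (\<Sum>b\<in>B. f b)"
    using B nonneg by (simp add: nn_integral_count_space_finite)
  also have "(\<Sum>b\<in>B. f b) = 1"
    using pos by (simp add: f_def sum_divide_distrib[symmetric] cong: sum.cong)
  finally have one: "(\<integral>\<^sup>+ b. ennreal (f b) \<partial>count_space UNIV) = 1" by simp
  show thesis
  proof (rule that[of "embed_pmf f"])
    show "set_pmf (embed_pmf f) = B"
      using x pos by (auto simp: set_embed_pmf[OF nonneg one] f_def dest: less_imp_neq[symmetric])
    show "pmf (embed_pmf f) b = x b / sum x B" if "b \<in> B" for b
      using that by (simp add: pmf_embed_pmf[OF nonneg one] f_def)
  qed
qed

text \<open>The weights \<open>x\<close> need not be probabilities: the gap is linear in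
  \<open>x\<close>, so its sign and its zeros survive positive rescaling.\<close>

definition payoff_gap ::
  "('a \<Rightarrow> 'b \<Rightarrow> real ^ 'm) \<Rightarrow> 'b set \<Rightarrow> ('b \<Rightarrow> real) \<Rightarrow> 'a \<Rightarrow> 'a \<Rightarrow> 'm \<Rightarrow> real" where
  "payoff_gap v B x a a' k = (\<Sum>b\<in>B. (v a b $ k - v a' b $ k) * x b)"

lemma pure_payoff_diff:
  fixes v :: "'a \<Rightarrow> 'b \<Rightarrow> real ^ 'm"
  assumes "finite T" "set_pmf t \<subseteq> T"
  shows "pure_payoff T v t a $ k - pure_payoff T v t a' $ k = payoff_gap v (set_pmf t) (pmf t) a a' k"
proof -
  have "pure_payoff T v t a $ k - pure_payoff T v t a' $ k
      = (\<Sum>b\<in>T. (v a b $ k - v a' b $ k) * pmf t b)"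
    by (simp add: pure_payoff_def sum_subtractf[symmetric] algebra_simps)
  also have "\<dots> = payoff_gap v (set_pmf t) (pmf t) a a' k"
    unfolding payoff_gap_def using assms
    by (intro sum.mono_neutral_right) (auto simp: set_pmf_iff)
  finally show ?thesis .
qed

lemma rlex_le_pure_payoff_iff:
  fixes v :: "'a \<Rightarrow> 'b \<Rightarrow> real ^ 'm::{finite,linorder}"
  assumes "finite T" "set_pmf t \<subseteq> T"
  defines "D \<equiv> payoff_gap v (set_pmf t) (pmf t)"
  shows "rlex_le (pure_payoff T v t a') (pure_payoff T v t a) \<longleftrightarrow>
    (\<forall>i. D a a' i = 0) \<or> (\<exists>k. D a a' k > 0 \<and> (\<forall>i>k. D a a' i = 0))"
proof -
  have D: "D a a' k = pure_payoff T v t a $ k - pure_payoff T v t a' $ k" for k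
    unfolding D_def by (rule pure_payoff_diff[OF assms(1,2), symmetric])
  show ?thesis by (auto simp: D rlex_le_def vec_eq_iff)
qed

text \<open>The player's own probabilities on \<open>A\<close> do not occur, only the opponent's on
  \<open>B\<close>. This is what decouples the two players.\<close>

definition optimal_against_support ::
  "'a set \<Rightarrow> 'b set \<Rightarrow> 'a set \<Rightarrow> 'b set \<Rightarrow> ('a \<Rightarrow> 'b \<Rightarrow> real ^ 'm::{finite,linorder}) \<Rightarrow> bool" where
  "optimal_against_support S T A B v \<longleftrightarrow> (\<exists>t. set_pmf t = B \<and>
     (\<forall>a\<in>A. \<forall>a'\<in>S. rlex_le (pure_payoff T v t a') (pure_payoff T v t a)))"

text \<open>The function \<kappa> records, for each pair of strategies, the coordinate deciding the
  lexicographic comparison, or \<open>None\<close> for a tie. Once it is fixed, the disjunctions in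
  \<open>rlex_le\<close> become a linear system.\<close>

lemma optimal_against_support_iff_linear:
  fixes v :: "'a \<Rightarrow> 'b \<Rightarrow> real ^ 'm::{finite,linorder}"
  assumes T: "finite T" "B \<subseteq> T"
  shows "optimal_against_support S T A B v \<longleftrightarrow> B \<noteq> {} \<and>
    (\<exists>\<kappa> \<in> A \<times> S \<rightarrow>\<^sub>E UNIV. \<exists>x. (\<forall>b\<in>B. x b > 0) \<and>
       (\<forall>a\<in>A. \<forall>a'\<in>S. case \<kappa> (a, a') of
           None \<Rightarrow> (\<forall>i. payoff_gap v B x a a' i = 0)
         | Some k \<Rightarrow> payoff_gap v B x a a' k > 0 \<and> (\<forall>i>k. payoff_gap v B x a a' i = 0)))"
    (is "_ \<longleftrightarrow> _ \<and> (\<exists>\<kappa>\<in>_. \<exists>x. _ \<and> (\<forall>a\<in>A. \<forall>a'\<in>S. ?C \<kappa> x a a'))")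
proof
  assume "optimal_against_support S T A B v"
  then obtain t where t: "set_pmf t = B" and
    opt: "\<And>a a'. a \<in> A \<Longrightarrow> a' \<in> S \<Longrightarrow> rlex_le (pure_payoff T v t a') (pure_payoff T v t a)"
    unfolding optimal_against_support_def by blast
  define R where "R a a' k \<longleftrightarrow> (case k of
           None \<Rightarrow> (\<forall>i. payoff_gap v B (pmf t) a a' i = 0)
         | Some k \<Rightarrow> payoff_gap v B (pmf t) a a' k > 0 \<and> (\<forall>i>k. payoff_gap v B (pmf t) a a' i = 0))"
    for a a' k
  have ex: "\<exists>k. R a a' k" if "a \<in> A" "a' \<in> S" for a a'
  proof -
    from opt[OF that] T t
    have "(\<forall>i. payoff_gap v B (pmf t) a a' i = 0) \<or>
        (\<exists>k. payoff_gap v B (pmf t) a a' k > 0 \<and> (\<forall>i>k. payoff_gap v B (pmf t) a a' i = 0))"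
      by (subst (asm) rlex_le_pure_payoff_iff) auto
    then have "R a a' None \<or> (\<exists>k. R a a' (Some k))" by (simp add: R_def)
    then show ?thesis by blast
  qed
  have R: "R a a' (SOME k. R a a' k)" if "a \<in> A" "a' \<in> S" for a a'
    by (rule someI_ex[OF ex[OF that]])
  define \<kappa> where "\<kappa> = (\<lambda>(a, a')\<in>A \<times> S. SOME k. R a a' k)"
  have "?C \<kappa> (pmf t) a a'" if "a \<in> A" "a' \<in> S" for a a'
    using R[OF that] that unfolding \<kappa>_def R_def by simp
  moreover have "\<forall>b\<in>B. pmf t b > 0" using t by (auto simp: pmf_positive)
  moreover have "\<kappa> \<in> A \<times> S \<rightarrow>\<^sub>E UNIV" by (simp add: \<kappa>_def)
  moreover have "B \<noteq> {}" using t set_pmf_not_empty by blast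
  ultimately show "B \<noteq> {} \<and> (\<exists>\<kappa>\<in>A \<times> S \<rightarrow>\<^sub>E UNIV. \<exists>x. (\<forall>b\<in>B. x b > 0) \<and> (\<forall>a\<in>A. \<forall>a'\<in>S. ?C \<kappa> x a a'))"
    by blast
next
  assume "B \<noteq> {} \<and> (\<exists>\<kappa>\<in>A \<times> S \<rightarrow>\<^sub>E UNIV. \<exists>x. (\<forall>b\<in>B. x b > 0) \<and> (\<forall>a\<in>A. \<forall>a'\<in>S. ?C \<kappa> x a a'))"
  then obtain \<kappa> x where B: "B \<noteq> {}" and x: "\<forall>b\<in>B. x b > 0"
    and C: "\<And>a a'. a \<in> A \<Longrightarrow> a' \<in> S \<Longrightarrow> ?C \<kappa> x a a'" by blast
  have "finite B" using T finite_subset by blast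
  with B x obtain t where t: "set_pmf t = B" "\<And>b. b \<in> B \<Longrightarrow> pmf t b = x b / sum x B"
    using ex_pmf_proportional[of B x] by blast
  have pos: "sum x B > 0" using \<open>finite B\<close> B x by (intro sum_pos) auto
  \<comment> \<open>Normalising divides every gap by the same positive number.\<close>
  have gap: "payoff_gap v B (pmf t) a a' k = payoff_gap v B x a a' k / sum x B" for a a' k
    unfolding payoff_gap_def sum_divide_distrib by (intro sum.cong) (auto simp: t(2))
  have "rlex_le (pure_payoff T v t a') (pure_payoff T v t a)" if "a \<in> A" "a' \<in> S" for a a'
    using C[OF that] T t(1) pos
    by (subst rlex_le_pure_payoff_iff)
       (auto simp: gap zero_less_divide_iff split: option.splits)
  with t(1) show "optimal_against_support S T A B v"
    unfolding optimal_against_support_def by blast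
qed

text \<open>A union of linear feasibility events over the finitely many choices of \<kappa>; for
  empty \<open>B\<close> the event is empty, since no distribution has empty support.\<close>

lemma sets_optimal_against_support:
  fixes v :: "'w \<Rightarrow> 'a \<Rightarrow> 'b \<Rightarrow> real ^ 'm::{finite,linorder}"
  assumes S: "finite S" "A \<subseteq> S" and T: "finite T" "B \<subseteq> T"
    and v: "\<And>a b i. a \<in> S \<Longrightarrow> b \<in> T \<Longrightarrow> (\<lambda>w. v w a b $ i) \<in> borel_measurable M"
  shows "{w \<in> space M. optimal_against_support S T A B (v w)} \<in> sets M"
proof (cases "B = {}")
  case True
  then show ?thesis by (simp add: optimal_against_support_def set_pmf_not_empty)
next
  case False
  \<comment> \<open>\<open>E\<close> lists the gaps required to vanish, \<open>F\<close> those
    required to be positive. The indices \<open>Inr b\<close> in \<open>F\<close> express positivity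
    of the weight at \<open>b\<close>.\<close>
  define E :: "('a \<times> 'a \<Rightarrow> 'm option) \<Rightarrow> ('a \<times> 'a \<times> 'm + 'b) set" where
    "E \<kappa> = Inl ` {(a, a', i). a \<in> A \<and> a' \<in> S \<and>
       (case \<kappa> (a, a') of None \<Rightarrow> True | Some k \<Rightarrow> k < i)}" for \<kappa>
  define F :: "('a \<times> 'a \<Rightarrow> 'm option) \<Rightarrow> ('a \<times> 'a \<times> 'm + 'b) set" where
    "F \<kappa> = Inl ` {(a, a', k). a \<in> A \<and> a' \<in> S \<and> \<kappa> (a, a') = Some k} \<union> Inr ` B" for \<kappa>
  define c where "c j b w = (case j of Inl (a, a', k) \<Rightarrow> v w a b $ k - v w a' b $ k
      | Inr b' \<Rightarrow> of_bool (b = b'))" for j b w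
  have fin: "finite A" "finite B" using S T finite_subset by auto
  have c_Inl: "(\<Sum>b\<in>B. c (Inl (a, a', k)) b w * x b) = payoff_gap (v w) B x a a' k" for a a' k w x
    by (simp add: c_def payoff_gap_def)
  have c_Inr: "(\<Sum>b\<in>B. c (Inr b') b w * x b) = x b'" if "b' \<in> B" for b' w x
    using fin that by (simp add: c_def of_bool_def if_distrib[of "\<lambda>a. a * _"] cong: if_cong)
  have sets: "{w \<in> space M. \<exists>x. (\<forall>j\<in>E \<kappa>. (\<Sum>b\<in>B. c j b w * x b) = 0) \<and>
                            (\<forall>j\<in>F \<kappa>. (\<Sum>b\<in>B. c j b w * x b) > 0)} \<in> sets M" for \<kappa>
  proof (rule sets_linear_feasibility)
    have "finite (A \<times> S \<times> (UNIV :: 'm set))" using fin S by simp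
    then show "finite (E \<kappa>)" "finite (F \<kappa>)"
      unfolding E_def F_def using fin
      by (auto intro!: finite_imageI elim!: finite_subset[rotated])
    show "c j b \<in> borel_measurable M" if "j \<in> E \<kappa> \<union> F \<kappa>" "b \<in> B" for j b
      using that S T unfolding c_def E_def F_def
      by (auto intro!: borel_measurable_diff v)
  qed (use fin in auto)
  have E: "(\<forall>j\<in>E \<kappa>. P j) \<longleftrightarrow> (\<forall>a\<in>A. \<forall>a'\<in>S. case \<kappa> (a, a') of None \<Rightarrow> (\<forall>i. P (Inl (a, a', i)))
      | Some k \<Rightarrow> (\<forall>i>k. P (Inl (a, a', i))))" for \<kappa> P
    unfolding E_def by (fastforce split: option.splits)
  have F: "(\<forall>j\<in>F \<kappa>. P j) \<longleftrightarrow> (\<forall>b\<in>B. P (Inr b)) \<and> (\<forall>a\<in>A. \<forall>a'\<in>S. case \<kappa> (a, a') of None \<Rightarrow> True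
      | Some k \<Rightarrow> P (Inl (a, a', k)))" for \<kappa> P
    unfolding F_def by (fastforce split: option.splits)
  have iff: "optimal_against_support S T A B (v w) \<longleftrightarrow>
    (\<exists>\<kappa> \<in> A \<times> S \<rightarrow>\<^sub>E UNIV. \<exists>x. (\<forall>j\<in>E \<kappa>. (\<Sum>b\<in>B. c j b w * x b) = 0) \<and>
                            (\<forall>j\<in>F \<kappa>. (\<Sum>b\<in>B. c j b w * x b) > 0))" for w
    unfolding optimal_against_support_iff_linear[OF T] E F c_Inl
    using False by (simp add: c_Inr split: option.splits) (intro bex_cong ex_cong1 refl; fast)
  have *: "{w \<in> space M. optimal_against_support S T A B (v w)} =
    (\<Union>\<kappa> \<in> A \<times> S \<rightarrow>\<^sub>E UNIV. {w \<in> space M. \<exists>x. (\<forall>j\<in>E \<kappa>. (\<Sum>b\<in>B. c j b w * x b) = 0) \<and>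
                            (\<forall>j\<in>F \<kappa>. (\<Sum>b\<in>B. c j b w * x b) > 0)})"
    unfolding iff by blast
  show ?thesis unfolding *
    using fin S by (intro sets.finite_UN sets finite_PiE) auto
qed

section \<open>Nash equilibria classified by their supports\<close>

lemma nash_equilibria_rlex_iff:
  fixes u :: "player \<Rightarrow> 'a \<Rightarrow> 'b \<Rightarrow> real ^ 'm::{finite,linorder}"
  assumes "finite S1" "finite S2"
  shows "(s1, s2) \<in> nash_equilibria rlex_le S1 S2 u \<longleftrightarrow> set_pmf s1 \<subseteq> S1 \<and> set_pmf s2 \<subseteq> S2 \<and>
    (\<forall>a\<in>set_pmf s1. \<forall>a'\<in>S1. rlex_le (pure_payoff S2 (u Player1) s2 a') (pure_payoff S2 (u Player1) s2 a)) \<and>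
    (\<forall>b\<in>set_pmf s2. \<forall>b'\<in>S2. rlex_le (pure_payoff S1 (\<lambda>b a. u Player2 a b) s1 b')
                                     (pure_payoff S1 (\<lambda>b a. u Player2 a b) s1 b))"
  using assms
  by (auto simp: nash_equilibria_iff_best_response rlex.best_response_iff mixed_strategies_def)

text \<open>For fixed supports, optimality of the first player restricts only \<open>s2\<close> and
  optimality of the second only \<open>s1\<close>, so separately found witnesses combine to an
  equilibrium.\<close>

lemma ex_nash_equilibrium_supports_iff:
  fixes u :: "player \<Rightarrow> 'a \<Rightarrow> 'b \<Rightarrow> real ^ 'm::{finite,linorder}"
  assumes "finite S1" "finite S2"
  shows "(\<exists>(s1, s2)\<in>nash_equilibria rlex_le S1 S2 u. Q (set_pmf s1) (set_pmf s2)) \<longleftrightarrow>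
    (\<exists>A\<in>Pow S1. \<exists>B\<in>Pow S2. Q A B \<and> optimal_against_support S1 S2 A B (u Player1) \<and>
       optimal_against_support S2 S1 B A (\<lambda>b a. u Player2 a b))"
  unfolding optimal_against_support_def Bex_def split_paired_Ex
  by (simp add: nash_equilibria_rlex_iff[OF assms]) blast

lemma sets_ex_nash_equilibrium_supports:
  fixes u :: "'w \<Rightarrow> player \<Rightarrow> 'a \<Rightarrow> 'b \<Rightarrow> real ^ 'm::{finite,linorder}"
  assumes S: "finite S1" "finite S2"
    and u: "\<And>p a b i. a \<in> S1 \<Longrightarrow> b \<in> S2 \<Longrightarrow> (\<lambda>w. u w p a b $ i) \<in> borel_measurable M"
  shows "{w \<in> space M. \<exists>(s1, s2)\<in>nash_equilibria rlex_le S1 S2 (u w). Q (set_pmf s1) (set_pmf s2)} \<in> sets M"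
proof -
  have "{w \<in> space M. Q A B \<and> optimal_against_support S1 S2 A B (u w Player1) \<and>
       optimal_against_support S2 S1 B A (\<lambda>b a. u w Player2 a b)} \<in> sets M"
    if "A \<in> Pow S1" "B \<in> Pow S2" for A B
    using that S
    by (intro sets.sets_Collect_conj sets.sets_Collect_const sets_optimal_against_support) (auto intro: u)
  then show ?thesis
    unfolding ex_nash_equilibrium_supports_iff[OF S]
    by (intro sets.sets_Collect_finite_Ex) (auto simp: S)
qed

lemma has_nash_iff_supports:
  "has_nash le S1 S2 u \<longleftrightarrow> (\<exists>(s1, s2)\<in>nash_equilibria le S1 S2 u. True)"
  by (auto simp: has_nash_def)

lemma has_nonpure_nash_iff_supports:
  "has_nonpure_nash le S1 S2 u \<longleftrightarrow> (\<exists>(s1, s2)\<in>nash_equilibria le S1 S2 u.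
     \<not> (is_singleton (set_pmf s1) \<and> is_singleton (set_pmf s2)))"
  by (auto simp: has_nonpure_nash_def is_singleton_def set_pmf_eq_singleton_iff pure_profile_iff Bex_def)

text \<open>Indifference on \<open>A\<close> with positivity and normalisation of the weights
  dropped, leaving a pure rank condition on the payoffs.\<close>

definition degenerate :: "'a set \<Rightarrow> 'b set \<Rightarrow> ('a \<Rightarrow> 'b \<Rightarrow> real ^ 'm) \<Rightarrow> bool" where
  "degenerate A B v \<longleftrightarrow>
     (\<exists>y. (\<exists>b\<in>B. y b \<noteq> 0) \<and> (\<forall>a\<in>A. \<forall>a'\<in>A. \<forall>k. payoff_gap v B y a a' k = 0))"

text \<open>Members of \<open>A\<close> dominate each other, hence tie in every coordinate by
  antisymmetry; the probabilities of \<open>t\<close> are the nonzero vector.\<close>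

lemma optimal_imp_degenerate:
  fixes v :: "'a \<Rightarrow> 'b \<Rightarrow> real ^ 'm::{finite,linorder}"
  assumes "finite T" "set_pmf t \<subseteq> T" "A \<subseteq> S"
    and opt: "\<forall>a\<in>A. \<forall>a'\<in>S. rlex_le (pure_payoff T v t a') (pure_payoff T v t a)"
  shows "degenerate A (set_pmf t) v"
  unfolding degenerate_def
proof (intro exI conjI ballI allI)
  show "\<exists>b\<in>set_pmf t. pmf t b \<noteq> 0" using set_pmf_not_empty[of t] by (auto simp: set_pmf_iff)
  fix a a' k assume "a \<in> A" "a' \<in> A"
  then have "pure_payoff T v t a = pure_payoff T v t a'"
    using opt assms(3) by (intro rlex.antisym) auto
  then show "payoff_gap v (set_pmf t) (pmf t) a a' k = 0"
    by (simp add: pure_payoff_diff[OF assms(1,2), symmetric])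
qed

lemma nonpure_nash_imp_degenerate:
  fixes u :: "player \<Rightarrow> 'a \<Rightarrow> 'b \<Rightarrow> real ^ 'm::{finite,linorder}"
  assumes S: "finite S1" "finite S2" and np: "has_nonpure_nash rlex_le S1 S2 u"
  shows "\<exists>A\<in>Pow S1. \<exists>B\<in>Pow S2.
    (2 \<le> card A \<and> card B \<le> card A \<and> degenerate A B (u Player1)) \<or>
    (2 \<le> card B \<and> card A \<le> card B \<and> degenerate B A (\<lambda>b a. u Player2 a b))"
proof -
  from np obtain s1 s2 where s: "(s1, s2) \<in> nash_equilibria rlex_le S1 S2 u"
    and nsing: "\<not> (is_singleton (set_pmf s1) \<and> is_singleton (set_pmf s2))"
    unfolding has_nonpure_nash_iff_supports by blast
  let ?A = "set_pmf s1" and ?B = "set_pmf s2"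
  note s = s[unfolded nash_equilibria_rlex_iff[OF S]]
  have "finite ?A" "finite ?B" using s S by (auto dest: finite_subset)
  then have "card ?A \<noteq> 0" "card ?B \<noteq> 0" using set_pmf_not_empty by auto
  moreover have "card ?A \<noteq> 1 \<or> card ?B \<noteq> 1" using nsing by (simp add: is_singleton_altdef)
  ultimately have "2 \<le> card ?A \<and> card ?B \<le> card ?A \<or> 2 \<le> card ?B \<and> card ?A \<le> card ?B" by linarith
  moreover have "degenerate ?A ?B (u Player1)" "degenerate ?B ?A (\<lambda>b a. u Player2 a b)"
    using s S by (auto intro!: optimal_imp_degenerate)
  ultimately show ?thesis using s by (intro bexI[of _ ?A] bexI[of _ ?B]) auto
qed

subsection \<open>Random games\<close>

text \<open>After fixing a row \<open>a0 \<in> A\<close>, indifference imposes \<open>CARD('m) * (card A - 1) \<ge> card A \<ge> card B\<close>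
  homogeneous equations on \<open>card B\<close> unknowns; a square subsystem, whose rows are chosen by the
  injection \<open>r\<close>, is almost surely regular.\<close>

lemma AE_not_degenerate:
  fixes e :: "'a \<Rightarrow> 'b \<Rightarrow> 'm::finite \<Rightarrow> 'i"
  assumes I: "finite I" and P: "prob_space P" "sets P = sets borel"
    and atomless: "\<And>x. emeasure P {x} = 0"
    and m: "CARD('m) \<ge> 2" and B: "finite B" "card B \<le> card A" and A: "2 \<le> card A"
    and e: "\<And>a b k. a \<in> A \<Longrightarrow> b \<in> B \<Longrightarrow> e a b k \<in> I"
    and inj: "\<And>a b k a' b' k'. e a b k = e a' b' k' \<Longrightarrow> a = a' \<and> b = b' \<and> k = k'"
  shows "AE w in PiM I (\<lambda>_. P). \<not> degenerate A B (\<lambda>a b. \<chi> k. w (e a b k))"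
proof -
  have fin: "finite A" using A by (auto intro: card_ge_0_finite)
  obtain a0 where a0: "a0 \<in> A" using A by fastforce
  \<comment> \<open>From \<open>card A \<ge> 2\<close> follows
    \<open>card A \<le> 2 * (card A - 1)\<close>; the factor 2 is then absorbed by the number of
    coordinates.\<close>
  have "card B \<le> (card A - 1) * 2" using A B by linarith
  also have "\<dots> \<le> (card A - 1) * CARD('m)" using m by (rule mult_le_mono2)
  also have "\<dots> = card ((A - {a0}) \<times> (UNIV :: 'm set))"
    using a0 fin by (simp add: card_cartesian_product)
  finally have "card B \<le> card ((A - {a0}) \<times> (UNIV :: 'm set))" .
  moreover have "finite ((A - {a0}) \<times> (UNIV :: 'm set))" using fin by simp
  ultimately obtain r where r: "r ` B \<subseteq> (A - {a0}) \<times> (UNIV :: 'm set)" "inj_on r B"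
    using B(1) card_le_inj by metis
  define row where "row b = fst (r b)" for b
  define coord where "coord b = snd (r b)" for b
  have row: "row b \<in> A" "row b \<noteq> a0" if "b \<in> B" for b
    using r(1) that by (auto simp: row_def)
  have r_eq: "b = b'" if "row b = row b'" "coord b = coord b'" "b \<in> B" "b' \<in> B" for b b'
    using r(2) that by (auto simp: row_def coord_def inj_on_def prod_eq_iff)
  define M where "M w b c = w (e (row b) c (coord b)) - w (e a0 c (coord b))" for w :: "'i \<Rightarrow> real" and b c
  have "AE w in PiM I (\<lambda>_. P). \<not> singular B (M w)"
  \<comment> \<open>The payoff entry at \<open>row b\<close>, column \<open>b\<close>, coordinate
    \<open>coord b\<close> occurs in \<open>M\<close> only at position \<open>(b, b)\<close>:
    \<open>r\<close> is injective, and the subtracted entries lie in the row \<open>a0\<close>,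
    which \<open>row\<close> avoids.\<close>
  proof (rule AE_not_singular[OF I P atomless B(1), where d = "\<lambda>b. e (row b) b (coord b)"])
    show "(\<lambda>w. M w b c) \<in> borel_measurable (PiM I (\<lambda>_. P))" if "b \<in> B" "c \<in> B" for b c
    proof -
      have comp: "(\<lambda>w. w i) \<in> borel_measurable (PiM I (\<lambda>_. P))" if "i \<in> I" for i
        using measurable_component_singleton[OF that, of "\<lambda>_. P"]
        by (simp add: measurable_cong_sets[OF refl P(2)])
      show ?thesis
        unfolding M_def using that row a0 by (intro borel_measurable_diff comp e) auto
    qed
    show "e (row b) b (coord b) \<in> I" if "b \<in> B" for b using that row by (intro e) auto
    show "x = x'" if "b \<in> B"
      "M (w(e (row b) b (coord b) := x)) b b = M (w(e (row b) b (coord b) := x')) b b" for w b x x'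
      using that row(2)[of b] by (auto simp: M_def dest: inj split: if_splits)
    show "M (w(e (row b) b (coord b) := x)) q c = M w q c"
      if "b \<in> B" "q \<in> B" "c \<in> B" "(q, c) \<noteq> (b, b)" for w b q c x
    proof -
      have "e (row q) c (coord q) \<noteq> e (row b) b (coord b)"
        using that r_eq[of q b] inj[of "row q" c "coord q" "row b" b "coord b"] by auto
      moreover have "e a0 c (coord q) \<noteq> e (row b) b (coord b)"
        using that row(2)[of b] inj[of a0 c "coord q" "row b" b "coord b"] by auto
      ultimately show ?thesis by (simp add: M_def)
    qed
  qed
  then show ?thesis
  proof eventually_elim
    case (elim w)
    show ?case
    proof
      assume "degenerate A B (\<lambda>a b. \<chi> k. w (e a b k))"
      then obtain y where y: "\<exists>b\<in>B. y b \<noteq> 0"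
        "\<And>a a' k. a \<in> A \<Longrightarrow> a' \<in> A \<Longrightarrow> payoff_gap (\<lambda>a b. \<chi> k. w (e a b k)) B y a a' k = 0"
        unfolding degenerate_def by blast
      have "(\<Sum>c\<in>B. M w b c * y c) = 0" if "b \<in> B" for b
        using y(2)[OF row(1)[OF that] a0, of "coord b"] by (simp add: payoff_gap_def M_def)
      with y(1) have "singular B (M w)" unfolding singular_def by blast
      with elim show False ..
    qed
  qed
qed

lemma AE_components_distinct:
  assumes I: "finite I" "i \<in> I" "j \<in> I" "i \<noteq> j" and P: "prob_space P" "sets P = sets borel"
    and atomless: "\<And>x :: real. emeasure P {x} = 0"
  shows "AE w in PiM I (\<lambda>_. P). w i \<noteq> w j"
proof (rule AE_PiM_countable_slices[OF I(1,2) P atomless])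
  have comp: "(\<lambda>w. w l) \<in> borel_measurable (PiM I (\<lambda>_. P))" if "l \<in> I" for l
    using measurable_component_singleton[OF that, of "\<lambda>_. P"]
    by (simp add: measurable_cong_sets[OF refl P(2)])
  show "{w \<in> space (PiM I (\<lambda>_. P)). w i = w j} \<in> sets (PiM I (\<lambda>_. P))"
    using comp I by (intro borel_measurable_eq) auto
  show "countable {x. (w(i := x)) i = (w(i := x)) j}" for w
    using I by simp
qed

text \<open>A unilateral deviation compares entries within one column for the first player and
  within one row for the second. Without ties there, the last coordinate alone decides
  \<open>rlex_le\<close>.\<close>

lemma has_pure_nash_last_coordinate_iff:
  fixes u :: "player \<Rightarrow> 'a \<Rightarrow> 'b \<Rightarrow> real ^ 'm::{finite,linorder}"
  assumes S: "finite S1" "finite S2"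
    and distinct1: "\<And>a a' b. a \<in> S1 \<Longrightarrow> a' \<in> S1 \<Longrightarrow> b \<in> S2 \<Longrightarrow> a \<noteq> a' \<Longrightarrow>
      u Player1 a b $ Max UNIV \<noteq> u Player1 a' b $ Max UNIV"
    and distinct2: "\<And>a b b'. a \<in> S1 \<Longrightarrow> b \<in> S2 \<Longrightarrow> b' \<in> S2 \<Longrightarrow> b \<noteq> b' \<Longrightarrow>
      u Player2 a b $ Max UNIV \<noteq> u Player2 a b' $ Max UNIV"
  shows "has_pure_nash (\<le>) S1 S2 (last_coordinate_game u) \<longleftrightarrow> has_pure_nash rlex_le S1 S2 u"
proof -
  have "rlex_le (u Player1 a' b) (u Player1 a b) \<longleftrightarrow> u Player1 a' b $ Max UNIV \<le> u Player1 a b $ Max UNIV"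
    if "a \<in> S1" "a' \<in> S1" "b \<in> S2" for a a' b
    using distinct1[OF that]
    by (cases "a = a'") (auto simp: rlex.refl dest: rlex_le_imp_last_le intro!: last_less_imp_rlex_le)
  moreover
  have "rlex_le (u Player2 a b') (u Player2 a b) \<longleftrightarrow> u Player2 a b' $ Max UNIV \<le> u Player2 a b $ Max UNIV"
    if "a \<in> S1" "b \<in> S2" "b' \<in> S2" for a b b'
    using distinct2[OF that]
    by (cases "b = b'") (auto simp: rlex.refl dest: rlex_le_imp_last_le intro!: last_less_imp_rlex_le)
  ultimately show ?thesis
    unfolding real_order.has_pure_nash_iff[OF S] rlex.has_pure_nash_iff[OF S] last_coordinate_game_def
    by (intro bex_cong refl conj_cong ball_cong) auto
qed

lemma has_nash_iff_pure_or_nonpure: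
  "has_nash le S1 S2 u \<longleftrightarrow> has_pure_nash le S1 S2 u \<or> has_nonpure_nash le S1 S2 u"
  by (auto simp: has_nash_def has_pure_nash_def has_nonpure_nash_def)

lemma finite_UNIV_player: "finite (UNIV :: player set)"
proof -
  have "UNIV = {Player1, Player2}" using player.exhaust by blast
  then show ?thesis by (metis finite.emptyI finite.insertI)
qed

theorem theorem4p51:
  fixes S1 :: "'a set" and S2 :: "'b set"
    and P :: "real measure"
    and M :: "'w measure"
    and G :: "'w \<Rightarrow> player \<Rightarrow> 'a \<Rightarrow> 'b \<Rightarrow> real ^ 'm::{finite,linorder}"
  assumes m: "CARD('m) \<ge> 2"
    and S1: "finite S1" "S1 \<noteq> {}"
    and S2: "finite S2" "S2 \<noteq> {}"
    and P: "real_distribution P" "absolutely_continuous lborel P"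
    and M: "prob_space M"
    and independent: "prob_space.indep_vars M (\<lambda>_. borel)
           (\<lambda>(p, \<sigma>1, \<sigma>2, i) \<omega>. G \<omega> p \<sigma>1 \<sigma>2 $ i) (UNIV \<times> S1 \<times> S2 \<times> UNIV)"
    and identically_distributed: "\<And>p \<sigma>1 \<sigma>2 i. \<sigma>1 \<in> S1 \<Longrightarrow> \<sigma>2 \<in> S2 \<Longrightarrow>
           distr M borel (\<lambda>\<omega>. G \<omega> p \<sigma>1 \<sigma>2 $ i) = P"
  shows "{\<omega> \<in> space M. has_nash rlex_le S1 S2 (G \<omega>)} \<in> sets M \<and>
         {\<omega> \<in> space M. has_pure_nash (\<le>) S1 S2 (last_coordinate_game (G \<omega>))} \<in> sets M \<and>
         {\<omega> \<in> space M. has_nonpure_nash rlex_le S1 S2 (G \<omega>)} \<in> sets M \<and>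
         measure M {\<omega> \<in> space M. has_nash rlex_le S1 S2 (G \<omega>)} =
         measure M {\<omega> \<in> space M. has_pure_nash (\<le>) S1 S2 (last_coordinate_game (G \<omega>))} \<and>
         measure M {\<omega> \<in> space M. has_nonpure_nash rlex_le S1 S2 (G \<omega>)} = 0"
proof -
  interpret M: prob_space M by fact
  interpret P: real_distribution P by fact
  have P': "prob_space P" "sets P = sets borel" by unfold_locales simp
  \<comment> \<open>Points are Lebesgue null, and absolute continuity passes null sets on to
    \<open>P\<close>.\<close>
  have atomless: "emeasure P {x} = 0" for x
  proof -
    have "{x} \<in> null_sets lborel" by (simp add: null_sets_def)
    then have "{x} \<in> null_sets P" using P(2) by (auto simp: absolutely_continuous_def)
    then show ?thesis by auto
  qed
  define I where "I = (UNIV :: player set) \<times> S1 \<times> S2 \<times> (UNIV :: 'm set)"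
  define X where "X = (\<lambda>(p, \<sigma>1, \<sigma>2, i) \<omega>. G \<omega> p \<sigma>1 \<sigma>2 $ i)"
  have I: "finite I" "I \<noteq> {}" using S1 S2 finite_UNIV_player by (auto simp: I_def)
  have ind: "M.indep_vars (\<lambda>_. borel) X I" using independent by (simp add: X_def I_def)
  have X: "X i \<in> borel_measurable M" if "i \<in> I" for i
    using ind that by (auto simp: M.indep_vars_def)
  have G: "(\<lambda>\<omega>. G \<omega> p a b $ i) \<in> borel_measurable M" if "a \<in> S1" "b \<in> S2" for p a b i
    using X[of "(p, a, b, i)"] that by (simp add: X_def I_def)
  \<comment> \<open>All payoff entries as one random vector. By independence and identical
    distribution its law is the product of copies of \<open>P\<close>, so almost-sure statements
    about the product space transfer to \<open>M\<close>.\<close>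
  let ?Y = "\<lambda>\<omega>. \<lambda>i\<in>I. X i \<omega>"
  have Y: "?Y \<in> measurable M (PiM I (\<lambda>_. borel))" using X by (intro measurable_restrict)
  have "M.indep_vars (\<lambda>_. borel) X I \<longleftrightarrow>
      distr M (PiM I (\<lambda>_. borel)) ?Y = PiM I (\<lambda>i. distr M borel (X i))"
    using I(2) X by (rule M.indep_vars_iff_distr_eq_PiM')
  with ind have "distr M (PiM I (\<lambda>_. borel)) ?Y = PiM I (\<lambda>i. distr M borel (X i))" by blast
  also have "\<dots> = PiM I (\<lambda>_. P)"
    using identically_distributed by (intro PiM_cong) (auto simp: X_def I_def)
  finally have distr_Y: "distr M (PiM I (\<lambda>_. borel)) ?Y = PiM I (\<lambda>_. P)" .
  have AE_via_Y: "AE \<omega> in M. Q (?Y \<omega>)" if "AE w in PiM I (\<lambda>_. P). Q w" for Q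
    using AE_distrD[OF Y] that unfolding distr_Y .
  have deg1: "AE \<omega> in M. \<not> degenerate A B (G \<omega> Player1)"
    if "A \<in> Pow S1" "B \<in> Pow S2" "2 \<le> card A" "card B \<le> card A" for A B
  proof -
    have "AE w in PiM I (\<lambda>_. P). \<not> degenerate A B (\<lambda>a b. \<chi> k. w (Player1, a, b, k))"
      using that S2 finite_subset
      by (intro AE_not_degenerate[OF I(1) P' atomless m]) (auto simp: I_def)
    from AE_via_Y[OF this] show ?thesis
    proof eventually_elim
      case (elim \<omega>)
      \<comment> \<open>On \<open>A\<close> and \<open>B\<close> the restriction to \<open>I\<close>
        is invisible, so the game and the vector \<open>?Y\<close> have the same gaps.\<close>
      have "payoff_gap (G \<omega> Player1) B y a a' k =
          payoff_gap (\<lambda>a b. \<chi> k. ?Y \<omega> (Player1, a, b, k)) B y a a' k" if "a \<in> A" "a' \<in> A" for y a a' k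
        unfolding payoff_gap_def using that \<open>A \<in> _\<close> \<open>B \<in> _\<close>
        by (intro sum.cong) (auto simp: I_def X_def)
      then show ?case using elim unfolding degenerate_def by simp
    qed
  qed
  have deg2: "AE \<omega> in M. \<not> degenerate B A (\<lambda>b a. G \<omega> Player2 a b)"
    if "A \<in> Pow S1" "B \<in> Pow S2" "2 \<le> card B" "card A \<le> card B" for A B
  proof -
    have "AE w in PiM I (\<lambda>_. P). \<not> degenerate B A (\<lambda>b a. \<chi> k. w (Player2, a, b, k))"
      using that S1 finite_subset
      by (intro AE_not_degenerate[OF I(1) P' atomless m]) (auto simp: I_def)
    from AE_via_Y[OF this] show ?thesis
    proof eventually_elim
      case (elim \<omega>)
      have "payoff_gap (\<lambda>b a. G \<omega> Player2 a b) A y b b' k =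
          payoff_gap (\<lambda>b a. \<chi> k. ?Y \<omega> (Player2, a, b, k)) A y b b' k" if "b \<in> B" "b' \<in> B" for y b b' k
        unfolding payoff_gap_def using that \<open>A \<in> _\<close> \<open>B \<in> _\<close>
        by (intro sum.cong) (auto simp: I_def X_def)
      then show ?case using elim unfolding degenerate_def by simp
    qed
  qed
  have distinct: "AE \<omega> in M. X i \<omega> \<noteq> X j \<omega>" if "i \<in> I" "j \<in> I" "i \<noteq> j" for i j
    using AE_via_Y[OF AE_components_distinct[OF I(1) that P' atomless]] that by simp
  have all_distinct: "AE \<omega> in M. \<forall>i\<in>I. \<forall>j\<in>I. i \<noteq> j \<longrightarrow> X i \<omega> \<noteq> X j \<omega>"
    using I(1) distinct by (intro AE_finite_allI AE_impI) auto
  \<comment> \<open>There are finitely many pairs of supports, so the exceptional null sets can be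
    united.\<close>
  have "AE \<omega> in M. \<forall>A\<in>Pow S1. \<forall>B\<in>Pow S2.
      (2 \<le> card A \<and> card B \<le> card A \<longrightarrow> \<not> degenerate A B (G \<omega> Player1)) \<and>
      (2 \<le> card B \<and> card A \<le> card B \<longrightarrow> \<not> degenerate B A (\<lambda>b a. G \<omega> Player2 a b))"
    using S1 S2 deg1 deg2 by (intro AE_finite_allI AE_conjI AE_impI) auto
  then have no_nonpure: "AE \<omega> in M. \<not> has_nonpure_nash rlex_le S1 S2 (G \<omega>)"
    by eventually_elim (use nonpure_nash_imp_degenerate[OF S1(1) S2(1)] in blast)
  have nash_iff: "AE \<omega> in M. has_nash rlex_le S1 S2 (G \<omega>) \<longleftrightarrow>
      has_pure_nash (\<le>) S1 S2 (last_coordinate_game (G \<omega>))"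
    using no_nonpure all_distinct
  proof eventually_elim
    case (elim \<omega>)
    have neq: "G \<omega> p a b $ Max UNIV \<noteq> G \<omega> p a' b' $ Max UNIV"
      if "a \<in> S1" "a' \<in> S1" "b \<in> S2" "b' \<in> S2" "(a, b) \<noteq> (a', b')" for p a b a' b'
      using elim(2)[rule_format, of "(p, a, b, Max UNIV)" "(p, a', b', Max UNIV)"] that
      by (auto simp: I_def X_def)
    have "has_pure_nash (\<le>) S1 S2 (last_coordinate_game (G \<omega>)) \<longleftrightarrow> has_pure_nash rlex_le S1 S2 (G \<omega>)"
      by (intro has_pure_nash_last_coordinate_iff neq S1 S2) auto
    then show ?case using elim(1) by (simp add: has_nash_iff_pure_or_nonpure)
  qed
  have sets_nash: "{\<omega> \<in> space M. has_nash rlex_le S1 S2 (G \<omega>)} \<in> sets M"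
    unfolding has_nash_iff_supports
    using S1 S2 G by (intro sets_ex_nash_equilibrium_supports) auto
  have sets_nonpure: "{\<omega> \<in> space M. has_nonpure_nash rlex_le S1 S2 (G \<omega>)} \<in> sets M"
    unfolding has_nonpure_nash_iff_supports
    using S1 S2 G by (intro sets_ex_nash_equilibrium_supports) auto
  \<comment> \<open>A finite Boolean combination of comparisons between measurable entries.\<close>
  have sets_pure: "{\<omega> \<in> space M. has_pure_nash (\<le>) S1 S2 (last_coordinate_game (G \<omega>))} \<in> sets M"
    unfolding real_order.has_pure_nash_iff[OF S1(1) S2(1)] last_coordinate_game_def
    using S1 S2 G
    by (intro sets.sets_Collect_finite_Ex sets.sets_Collect_conj sets.sets_Collect_finite_All'
        borel_measurable_le) auto
  have "measure M {\<omega> \<in> space M. has_nash rlex_le S1 S2 (G \<omega>)} =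
      measure M {\<omega> \<in> space M. has_pure_nash (\<le>) S1 S2 (last_coordinate_game (G \<omega>))}"
    using nash_iff by (intro measure_eq_AE sets_nash sets_pure) auto
  moreover have "measure M {\<omega> \<in> space M. has_nonpure_nash rlex_le S1 S2 (G \<omega>)} = 0"
    using no_nonpure sets_nonpure by (subst M.prob_eq_0) auto
  ultimately show ?thesis using sets_nash sets_pure sets_nonpure by blast
qed

end
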